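(* Consider the online assignment problem where clients are inserted one by one (with all incident edges) into a bipartite graph with fixed server set $S$, and the algorithm must at all times maintain an assignment of minimum possible maximum load. The SAP algorithm, upon insertion of a client $c$, first computes $\mathrm{opt}$ of the new graph; if it increased, $c$ is assigned to an arbitrary neighbor; otherwise it augments along a shortest augmenting path from $c$ to a server $s$ with $\ell(s)<\mathrm{opt}$. Let $C$ be the set of all clients inserted, $n=|C|$, and $L=\mathrm{opt}(G)$ for the final graph $G=(C\cup S,E)$. Then SAP at all times maintains an optimal assignment while making a total of $O\big(n\min\{L\log^2 n,\ \sqrt{n}\log n\}\big)$ reassignments.
   Context: An assignment maps each client to a neighboring server; the load $\ell(s)$ of a server is the number of clients assigned to it; $\mathrm{opt}(G)$ is the minimum over all assignments of the maximum load (every client is assumed to have at least one neighbor so that assignments exist). An augmenting path from the new client $c$ alternates between edges not in the assignment and edges in the assignment (a server may have several assignment edges) and ends at a server with $\ell(s)<\mathrm{opt}$; augmenting flips the status of its edges. *)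

theory Defs
  imports Complex_Main
begin

text \<open>An assignment of the client set \<open>C\<close> is a partial map with domain \<open>C\<close>; its set of edges
  is \<open>Map.graph A\<close>. Edges at clients outside \<open>C\<close> (not yet inserted) play no role.\<close>

definition is_assignment :: "('c \<times> 's) set \<Rightarrow> 'c set \<Rightarrow> ('c \<rightharpoonup> 's) \<Rightarrow> bool" where
  "is_assignment E C A \<longleftrightarrow> dom A = C \<and> Map.graph A \<subseteq> E"

definition load :: "('c \<rightharpoonup> 's) \<Rightarrow> 's \<Rightarrow> nat" where
  "load A s = card {c. A c = Some s}"

text \<open>On \<open>nat\<close> the supremum of a nonempty finite set is its maximum, and that of the empty set
  is \<open>0\<close>.\<close>

definition max_load :: "'s set \<Rightarrow> ('c \<rightharpoonup> 's) \<Rightarrow> nat" where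
  "max_load S A = (SUP s\<in>S. load A s)"

definition opt :: "'s set \<Rightarrow> ('c \<times> 's) set \<Rightarrow> 'c set \<Rightarrow> nat" where
  "opt S E C = (LEAST k. \<exists>A. is_assignment E C A \<and> max_load S A = k)"

definition optimal_assignment ::
    "'s set \<Rightarrow> ('c \<times> 's) set \<Rightarrow> 'c set \<Rightarrow> ('c \<rightharpoonup> 's) \<Rightarrow> bool" where
  "optimal_assignment S E C A \<longleftrightarrow> is_assignment E C A \<and> max_load S A = opt S E C"

text \<open>The alternating path \<open>c\<^sub>0 s\<^sub>0 c\<^sub>1 s\<^sub>1 \<dots> c\<^sub>m s\<^sub>m\<close> is represented by the list
  \<open>[(c\<^sub>0, s\<^sub>0), \<dots>, (c\<^sub>m, s\<^sub>m)]\<close> of its non-assignment edges; its other edges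
  \<open>(c\<^sub>i\<^sub>+\<^sub>1, s\<^sub>i)\<close> belong to the assignment. It has \<open>2 * length p - 1\<close> edges, so shortest paths
  are those of least list length. All clients but the first are assigned, hence already inserted.\<close>

definition augmenting_path ::
    "('c \<times> 's) set \<Rightarrow> nat \<Rightarrow> ('c \<rightharpoonup> 's) \<Rightarrow> 'c \<Rightarrow> ('c \<times> 's) list \<Rightarrow> bool" where
  "augmenting_path E k A c p \<longleftrightarrow>
     p \<noteq> [] \<and> fst (hd p) = c \<and> distinct (map fst p) \<and> distinct (map snd p) \<and>
     set p \<subseteq> E - Map.graph A \<and>
     (\<forall>i. Suc i < length p \<longrightarrow> (fst (p ! Suc i), snd (p ! i)) \<in> Map.graph A) \<and>
     load A (snd (last p)) < k"

definition shortest_augmenting_path ::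
    "('c \<times> 's) set \<Rightarrow> nat \<Rightarrow> ('c \<rightharpoonup> 's) \<Rightarrow> 'c \<Rightarrow> ('c \<times> 's) list \<Rightarrow> bool" where
  "shortest_augmenting_path E k A c p \<longleftrightarrow>
     augmenting_path E k A c p \<and> (\<forall>q. augmenting_path E k A c q \<longrightarrow> length p \<le> length q)"

definition path_edges :: "('c \<times> 's) list \<Rightarrow> ('c \<times> 's) set" where
  "path_edges p = set p \<union> {(fst (p ! Suc i), snd (p ! i)) | i. Suc i < length p}"

text \<open>\<open>sap_step S E C c A A'\<close>: when \<open>c\<close> is inserted into the graph with clients \<open>C\<close> and current
  assignment \<open>A\<close>, \<open>A'\<close> is a possible next assignment. A relation, because the neighbour in the
  first case and the shortest path in the second are arbitrary.\<close>

definition sap_step ::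
    "'s set \<Rightarrow> ('c \<times> 's) set \<Rightarrow> 'c set \<Rightarrow> 'c \<Rightarrow> ('c \<rightharpoonup> 's) \<Rightarrow> ('c \<rightharpoonup> 's) \<Rightarrow> bool" where
  "sap_step S E C c A A' \<longleftrightarrow>
     (if opt S E C < opt S E (insert c C)
      then \<exists>s. (c, s) \<in> E \<and> A' = A(c \<mapsto> s)
      else \<exists>p. shortest_augmenting_path E (opt S E (insert c C)) A c p \<and>
               Map.graph A' = sym_diff (Map.graph A) (path_edges p))"

definition sap_run ::
    "'s set \<Rightarrow> ('c \<times> 's) set \<Rightarrow> 'c list \<Rightarrow> ('c \<rightharpoonup> 's) list \<Rightarrow> bool" where
  "sap_run S E cs As \<longleftrightarrow>
     length As = Suc (length cs) \<and> As ! 0 = Map.empty \<and>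
     (\<forall>i < length cs. sap_step S E (set (take i cs)) (cs ! i) (As ! i) (As ! Suc i))"

text \<open>The first assignment of a newly inserted client is not a reassignment.\<close>

definition reassignments :: "('c \<rightharpoonup> 's) \<Rightarrow> ('c \<rightharpoonup> 's) \<Rightarrow> nat" where
  "reassignments A A' = card {c \<in> dom A. A' c \<noteq> A c}"

definition total_reassignments :: "('c \<rightharpoonup> 's) list \<Rightarrow> nat" where
  "total_reassignments As = (\<Sum>i < length As - 1. reassignments (As ! i) (As ! Suc i))"

definition online_instance :: "'s set \<Rightarrow> ('c \<times> 's) set \<Rightarrow> 'c list \<Rightarrow> bool" where
  "online_instance S E cs \<longleftrightarrow>
     finite S \<and> distinct cs \<and> E \<subseteq> set cs \<times> S \<and> (\<forall>c \<in> set cs. \<exists>s. (c, s) \<in> E)"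

end

theory Submission
  imports Defs
begin

text \<open>
  Write \<open>N(K)\<close> for the neighbourhood of a client set \<open>K\<close>. Consider the phase in which the optimum
  is \<open>k\<close>, let \<open>0 < \<delta> \<le> 1/2\<close>, put \<open>x = k (1 - \<delta>)\<close>, and let \<open>K\<^sup>*\<close> maximise the excess
  \<open>|K| - x |N(K)|\<close> over the client sets \<open>K\<close> inserted so far.

  If the new client \<open>c\<close> has a neighbour outside \<open>N(K\<^sup>*)\<close>, look at the servers outside \<open>N(K\<^sup>*)\<close>
  reached from \<open>c\<close> in \<open>j\<close> rounds of alternating search. As long as they all have load \<open>k\<close>, adding
  the clients assigned to them to \<open>K\<^sup>*\<close> cannot raise the excess, so their number grows by a factor
  \<open>1 / (1 - \<delta>)\<close> in each round; hence the shortest augmenting path has \<open>O(log n / \<delta>)\<close> edges.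
  If instead \<open>N(c) \<subseteq> N(K\<^sup>*)\<close>, then adding \<open>c\<close> to \<open>K\<^sup>*\<close> shows that the maximum excess grows by
  at least 1. It never decreases, and at the end of the phase it is at most \<open>2 \<delta> n\<close> because
  \<open>|K| \<le> k |N(K)|\<close> for all \<open>K\<close>. So in each phase at most \<open>O(n log n / h)\<close> insertions
  cause \<open>h\<close> or more reassignments.

  All servers of a shortest path but the last have load \<open>k\<close>, so \<open>h\<close> reassignments require
  \<open>k h \<le> n\<close>. Thus at most \<open>min(L, n/h)\<close> phases contribute at level \<open>h\<close>, and summing over \<open>h\<close>
  gives both bounds: \<open>L n log n \<cdot> \<Sum>\<^sub>h 1/h\<close>, and, with the levels \<open>h \<le> \<surd>n\<close> bounded trivially,
  \<open>n \<surd>n + n\<^sup>2 log n \<cdot> \<Sum> 1/h\<^sup>2\<close> over \<open>h > \<surd>n\<close>.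
\<close>

section \<open>Loads and optimal assignments\<close>

lemma max_load_le_iff:
  assumes "finite S"
  shows "max_load S A \<le> k \<longleftrightarrow> (\<forall>s\<in>S. load A s \<le> k)"
proof (cases "S = {}")
  case True
  then show ?thesis by (simp add: max_load_def)
next
  case False
  with assms show ?thesis
    unfolding max_load_def by (subst cSUP_le_iff) auto
qed

lemma opt_le_max_load: "is_assignment E C A \<Longrightarrow> opt S E C \<le> max_load S A"
  unfolding opt_def by (rule Least_le) blast

lemma optimal_assignment_exists:
  assumes "C \<subseteq> Domain E"
  obtains A where "optimal_assignment S E C A"
proof -
  from assms have "\<forall>c\<in>C. \<exists>s. (c, s) \<in> E" by blast
  then obtain f where f: "\<forall>c\<in>C. (c, f c) \<in> E" by metis
  define A0 where "A0 = (\<lambda>c. if c \<in> C then Some (f c) else None)"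
  have "is_assignment E C A0"
    using f by (auto simp: is_assignment_def A0_def Map.graph_def dom_def split: if_splits)
  then have "\<exists>k A. is_assignment E C A \<and> max_load S A = k" by blast
  then have "\<exists>A. is_assignment E C A \<and> max_load S A = opt S E C"
    unfolding opt_def by (rule LeastI_ex)
  then show ?thesis using that by (auto simp: optimal_assignment_def)
qed

lemma card_assigned_to:
  assumes "finite (dom A)" "finite T"
  shows "card {c. \<exists>s\<in>T. A c = Some s} = (\<Sum>s\<in>T. load A s)"
proof -
  have "{c. \<exists>s\<in>T. A c = Some s} = (\<Union>s\<in>T. {c. A c = Some s})" by auto
  moreover have "finite {c. A c = Some s}" for s
    by (rule finite_subset[OF _ assms(1)]) auto
  moreover have "card (\<Union>s\<in>T. {c. A c = Some s}) = (\<Sum>s\<in>T. card {c. A c = Some s})"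
    using assms(2) calculation(2) by (intro card_UN_disjoint) auto
  ultimately show ?thesis by (simp add: load_def)
qed

lemma saturated_card_le:
  assumes "finite (dom A)" "finite T" "\<And>s. s \<in> T \<Longrightarrow> k \<le> load A s"
  shows "k * card T \<le> card {c. \<exists>s\<in>T. A c = Some s}"
  using sum_bounded_below[of T k "load A"] assms
  by (simp add: card_assigned_to mult.commute)

lemma saturated_card_le_dom:
  assumes "finite (dom A)" "finite T" "\<And>s. s \<in> T \<Longrightarrow> k \<le> load A s"
  shows "k * card T \<le> card (dom A)"
proof -
  have "card {c. \<exists>s\<in>T. A c = Some s} \<le> card (dom A)"
    by (rule card_mono) (use assms in auto)
  then show ?thesis using saturated_card_le[OF assms] by linarith
qed

text \<open>Only the server side is fixed. Client sets are arguments, since the lemmas are applied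
  to every prefix of the insertion order.\<close>

locale server_graph =
  fixes S :: "'s set" and E :: "('c \<times> 's) set"
  assumes finite_S: "finite S" and Range_E: "Range E \<subseteq> S"
begin

lemma finite_neighbours: "finite (E `` K)"
  by (rule finite_subset[OF _ finite_S]) (use Range_E in auto)

lemma optimal_assignmentI:
  assumes "is_assignment E C A" "\<And>s. s \<in> S \<Longrightarrow> load A s \<le> opt S E C"
  shows "optimal_assignment S E C A"
  using assms opt_le_max_load[of E C A S] max_load_le_iff[OF finite_S, of A "opt S E C"]
  by (auto simp: optimal_assignment_def)

lemma load_le_opt:
  assumes "optimal_assignment S E C A" "s \<in> S"
  shows "load A s \<le> opt S E C"
  using assms max_load_le_iff[OF finite_S, of A "opt S E C"]
  by (auto simp: optimal_assignment_def)

text \<open>The counting half of a Hall-type duality: an optimal assignment sends \<open>K\<close>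
  into \<open>T\<close>, and no server of \<open>T\<close> receives more than the optimum. It bounds
  the excess and yields the existence of augmenting paths.\<close>

lemma card_le_opt_mult:
  assumes "finite C" "C \<subseteq> Domain E" "K \<subseteq> C" "E `` K \<subseteq> T" "T \<subseteq> S"
  shows "card K \<le> opt S E C * card T"
proof -
  obtain A where A: "optimal_assignment S E C A"
    using optimal_assignment_exists[OF assms(2)] .
  then have domA: "dom A = C" and gr: "Map.graph A \<subseteq> E"
    by (auto simp: optimal_assignment_def is_assignment_def)
  have finT: "finite T" using assms(5) finite_S finite_subset by blast
  have "K \<subseteq> {c. \<exists>s\<in>T. A c = Some s}"
  proof
    fix c assume c: "c \<in> K"
    then obtain s where s: "A c = Some s" using assms(3) domA by blast
    then have "(c, s) \<in> E" using gr by (auto simp: Map.graph_def)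
    then show "c \<in> {c. \<exists>s\<in>T. A c = Some s}" using s c assms(4) by auto
  qed
  moreover have "finite {c. \<exists>s\<in>T. A c = Some s}"
    by (rule finite_subset[OF _ assms(1)]) (use domA in auto)
  ultimately have "card K \<le> card {c. \<exists>s\<in>T. A c = Some s}" by (rule card_mono[rotated])
  also have "\<dots> = (\<Sum>s\<in>T. load A s)"
    using assms(1) domA finT by (simp add: card_assigned_to)
  also have "\<dots> \<le> opt S E C * card T"
    using sum_bounded_above[of T "load A" "opt S E C"] load_le_opt[OF A] assms(5)
    by (simp add: mult.commute subset_iff)
  finally show ?thesis .
qed

text \<open>An optimal assignment of the larger client set restricts to the smaller one without
  raising any load.\<close>

lemma opt_mono:
  assumes "finite D" "D \<subseteq> Domain E" "C \<subseteq> D"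
  shows "opt S E C \<le> opt S E D"
proof -
  obtain A where A: "optimal_assignment S E D A"
    using optimal_assignment_exists[OF assms(2)] .
  then have D: "dom A = D" "Map.graph A \<subseteq> E"
    by (auto simp: optimal_assignment_def is_assignment_def)
  have "is_assignment E C (A |` C)"
    using D assms(3) by (auto simp: is_assignment_def Map.graph_def restrict_map_def split: if_splits)
  moreover have "load (A |` C) s \<le> load A s" for s
    unfolding load_def
    by (rule card_mono, rule finite_subset[OF _ assms(1)])
      (use D in \<open>auto simp: restrict_map_def split: if_splits\<close>)
  then have "max_load S (A |` C) \<le> opt S E D"
    using load_le_opt[OF A] max_load_le_iff[OF finite_S] order_trans by blast
  ultimately show ?thesis using opt_le_max_load order_trans by blast
qed

end

section \<open>Alternating paths\<close>

text \<open>The load condition at the end is dropped, so that every nonempty prefix of a path is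
  again a path.\<close>

definition alternating_path ::
    "('c \<times> 's) set \<Rightarrow> ('c \<rightharpoonup> 's) \<Rightarrow> 'c \<Rightarrow> ('c \<times> 's) list \<Rightarrow> bool" where
  "alternating_path E A c p \<longleftrightarrow>
     p \<noteq> [] \<and> fst (hd p) = c \<and> distinct (map fst p) \<and> distinct (map snd p) \<and>
     set p \<subseteq> E - Map.graph A \<and>
     (\<forall>i. Suc i < length p \<longrightarrow> A (fst (p ! Suc i)) = Some (snd (p ! i)))"

lemma augmenting_path_iff:
  "augmenting_path E k A c p \<longleftrightarrow> alternating_path E A c p \<and> load A (snd (last p)) < k"
  by (auto simp: augmenting_path_def alternating_path_def Map.graph_def)

lemma alternating_path_take:
  assumes "alternating_path E A c p" "0 < j"
  shows "alternating_path E A c (take j p)"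
  using assms set_take_subset[of j p]
  by (auto simp: alternating_path_def take_map[symmetric])

lemma alternating_path_singleton:
  assumes "(c, s) \<in> E" "c \<notin> dom A"
  shows "alternating_path E A c [(c, s)]"
  using assms by (auto simp: alternating_path_def Map.graph_def)

text \<open>If \<open>s\<close> is already visited, truncating the path at \<open>s\<close>
  suffices. Otherwise the edge is appended, and \<open>c'\<close> is new: it is not the unassigned
  \<open>c\<close>, and any other client on the path is preceded by its own server, which for
  \<open>c'\<close> is the last server and so precedes no client.\<close>

lemma alternating_path_extend:
  assumes p: "alternating_path E A c p" and "c \<notin> dom A"
    and c': "A c' = Some (snd (last p))" and s: "(c', s) \<in> E"
  obtains q where "alternating_path E A c q" "snd (last q) = s" "length q \<le> Suc (length p)"
proof (cases "s \<in> snd ` set p")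
  case True
  then obtain j where j: "j < length p" "snd (p ! j) = s" by (auto simp: in_set_conv_nth)
  have "snd (last (take (Suc j) p)) = s" using j by (simp add: take_Suc_conv_app_nth)
  then show ?thesis using that[of "take (Suc j) p"] alternating_path_take[OF p] by simp
next
  case False
  have ne: "p \<noteq> []" using p by (simp add: alternating_path_def)
  have "c' \<notin> fst ` set p"
  proof
    assume "c' \<in> fst ` set p"
    then obtain j where j: "j < length p" "fst (p ! j) = c'" by (auto simp: in_set_conv_nth)
    show False
    proof (cases j)
      case 0
      then show False using j p ne \<open>c \<notin> dom A\<close> c'
        by (auto simp: alternating_path_def hd_conv_nth)
    next
      case (Suc i)
      then have "map snd p ! i = map snd p ! (length p - 1)"
        using p j c' ne by (auto simp: alternating_path_def last_conv_nth)
      then have "i = length p - 1"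
        using p Suc j nth_eq_iff_index_eq[of "map snd p" i "length p - 1"]
        by (simp add: alternating_path_def)
      then show False using Suc j by simp
    qed
  qed
  moreover have "(c', s) \<notin> Map.graph A"
    using c' False ne by (auto simp: Map.graph_def)
  moreover have "A (fst ((p @ [(c', s)]) ! Suc i)) = Some (snd ((p @ [(c', s)]) ! i))"
    if "Suc i < length (p @ [(c', s)])" for i
  proof (cases "Suc i < length p")
    case True
    then show ?thesis using p by (simp add: alternating_path_def nth_append)
  next
    case False
    then have "Suc i = length p" using that by simp
    then have "i = length p - 1" "i < length p" by simp_all
    then show ?thesis using c' ne \<open>Suc i = length p\<close>
      by (simp add: nth_append last_conv_nth)
  qed
  ultimately have "alternating_path E A c (p @ [(c', s)])"
    using p s False unfolding alternating_path_def by auto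
  then show ?thesis using that[of "p @ [(c', s)]"] by simp
qed

text \<open>These are balls of the alternating search, not spheres: bounding the length absorbs the
  truncation in \<open>alternating_path_extend\<close>.\<close>

definition reach :: "('c \<times> 's) set \<Rightarrow> ('c \<rightharpoonup> 's) \<Rightarrow> 'c \<Rightarrow> nat \<Rightarrow> 's set" where
  "reach E A c j = {snd (last p) | p. alternating_path E A c p \<and> length p \<le> j}"

lemma reach_one:
  assumes "c \<notin> dom A" shows "E `` {c} \<subseteq> reach E A c (Suc 0)"
proof
  fix s assume "s \<in> E `` {c}"
  then have "alternating_path E A c [(c, s)]" using alternating_path_singleton[OF _ assms] by auto
  then show "s \<in> reach E A c (Suc 0)" unfolding reach_def by force
qed

lemma reach_Suc:
  assumes "c \<notin> dom A" "s' \<in> reach E A c j" "A c' = Some s'" "(c', s) \<in> E"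
  shows "s \<in> reach E A c (Suc j)"
proof -
  obtain p where p: "alternating_path E A c p" "length p \<le> j" "s' = snd (last p)"
    using assms(2) by (auto simp: reach_def)
  then obtain q where "alternating_path E A c q" "snd (last q) = s" "length q \<le> Suc (length p)"
    using alternating_path_extend[OF p(1) assms(1) _ assms(4)] assms(3) by metis
  then show ?thesis using p(2) unfolding reach_def by force
qed

lemma reach_subset_Range: "reach E A c j \<subseteq> Range E"
proof
  fix s assume "s \<in> reach E A c j"
  then obtain p where "p \<noteq> []" "set p \<subseteq> E" "s = snd (last p)"
    by (auto simp: reach_def alternating_path_def)
  then show "s \<in> Range E" using last_in_set[of p] by (metis Range.intros prod.collapse subsetD)
qed

text \<open>A less loaded server would end an augmenting path shorter than the shortest one.\<close>

lemma reach_saturated: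
  assumes "shortest_augmenting_path E k A c p" "s \<in> reach E A c j" "j < length p"
  shows "k \<le> load A s"
proof (rule ccontr)
  assume "\<not> k \<le> load A s"
  moreover obtain q where "alternating_path E A c q" "length q \<le> j" "s = snd (last q)"
    using assms(2) by (auto simp: reach_def)
  ultimately have "augmenting_path E k A c q" by (simp add: augmenting_path_iff)
  then show False using assms \<open>length q \<le> j\<close> by (fastforce simp: shortest_augmenting_path_def)
qed

section \<open>Augmenting along a path\<close>

lemma alternating_path_nth:
  assumes p: "alternating_path E A c p" and "c \<notin> dom A" and j: "j < length p"
  shows "A (fst (p ! j)) = (if j = 0 then None else Some (snd (p ! (j - 1))))"
proof (cases j)
  case 0
  then show ?thesis using assms by (auto simp: alternating_path_def hd_conv_nth)
next
  case (Suc i)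
  then show ?thesis using assms by (auto simp: alternating_path_def)
qed

text \<open>Each client on the path trades the preceding server for the following one, and
  \<open>c\<close>, which has no preceding server, only gains one. So flipping edges is the same as
  overriding the map with the path.\<close>

lemma graph_augment:
  assumes p: "alternating_path E A c p" and c: "c \<notin> dom A"
  shows "Map.graph (A ++ map_of p) = sym_diff (Map.graph A) (path_edges p)"
proof -
  have dist: "distinct (map fst p)" "distinct (map snd p)"
    and off: "set p \<inter> Map.graph A = {}" using p by (auto simp: alternating_path_def)
  have "(x, s) \<in> Map.graph (A ++ map_of p) \<longleftrightarrow>
        (x, s) \<in> sym_diff (Map.graph A) (path_edges p)" for x s
  proof (cases "x \<in> fst ` set p")
    case False
    then have "map_of p x = None" by (simp add: map_of_eq_None_iff)
    moreover have "(x, s) \<notin> path_edges p"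
    proof
      assume "(x, s) \<in> path_edges p"
      then have "(x, s) \<in> set p \<or> (\<exists>i. Suc i < length p \<and> x = fst (p ! Suc i))"
        by (auto simp: path_edges_def)
      then show False using False by (metis fst_conv image_eqI nth_mem)
    qed
    ultimately show ?thesis by (auto simp: Map.graph_def map_add_def)
  next
    case True
    then obtain j where j: "j < length p" "x = fst (p ! j)" by (auto simp: in_set_conv_nth)
    have idx: "i = j" if "i < length p" "fst (p ! i) = x" for i
      using that j dist nth_eq_iff_index_eq[of "map fst p" i j] by simp
    have pj: "p ! j = (x, snd (p ! j))" "p ! j \<in> set p" using j by auto
    then have "map_of p x = Some (snd (p ! j))" using dist by (metis map_of_is_SomeI)
    then have lhs: "(x, s) \<in> Map.graph (A ++ map_of p) \<longleftrightarrow> s = snd (p ! j)"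
      by (auto simp: Map.graph_def map_add_def)
    have gA: "(x, s) \<in> Map.graph A \<longleftrightarrow> j \<noteq> 0 \<and> s = snd (p ! (j - 1))"
      using alternating_path_nth[OF p c j(1)] j(2) by (auto simp: Map.graph_def)
    have inp: "(x, s) \<in> set p \<longleftrightarrow> s = snd (p ! j)"
      using idx pj by (metis fst_conv in_set_conv_nth snd_conv)
    have link: "(\<exists>i. (x, s) = (fst (p ! Suc i), snd (p ! i)) \<and> Suc i < length p) \<longleftrightarrow>
        j \<noteq> 0 \<and> s = snd (p ! (j - 1))"
      using idx j by (cases j) force+
    have "(x, s) \<in> path_edges p \<longleftrightarrow> s = snd (p ! j) \<or> j \<noteq> 0 \<and> s = snd (p ! (j - 1))"
      using inp link by (simp add: path_edges_def)
    \<comment> \<open>The new edge of \<open>x\<close> is never an old one, so in the symmetric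
      difference the old edge cancels and the new one survives.\<close>
    moreover have "\<not> ((x, s) \<in> Map.graph A \<and> s = snd (p ! j))"
      using off inp by blast
    ultimately show ?thesis using lhs gA by auto
  qed
  then show ?thesis by (metis (no_types, lifting) subrelI subset_antisym)
qed

lemma map_graph_inject: "Map.graph A = Map.graph B \<Longrightarrow> A = B"
proof
  fix x assume "Map.graph A = Map.graph B"
  then have "A x = Some s \<longleftrightarrow> B x = Some s" for s
    by (auto simp: Map.graph_def set_eq_iff)
  then show "A x = B x" by (metis not_None_eq)
qed

text \<open>A server on the path gains the client before it and, unless it is the last, loses the
  client after it.\<close>

lemma load_augment_le:
  assumes p: "alternating_path E A c p" and c: "c \<notin> dom A" and fin: "finite (dom A)"
  shows "load (A ++ map_of p) s \<le> load A s + (if s = snd (last p) then 1 else 0)"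
proof -
  have dist: "distinct (map fst p)" "distinct (map snd p)" and ne: "p \<noteq> []"
    using p by (auto simp: alternating_path_def)
  have finA: "finite {x. A x = Some s}" by (rule finite_subset[OF _ fin]) auto
  have new: "{x. (A ++ map_of p) x = Some s} \<subseteq>
      {x. (x, s) \<in> set p} \<union> {x. A x = Some s \<and> x \<notin> fst ` set p}"
  proof
    fix x assume "x \<in> {x. (A ++ map_of p) x = Some s}"
    then have "map_of p x = Some s \<or> map_of p x = None \<and> A x = Some s" by auto
    then show "x \<in> {x. (x, s) \<in> set p} \<union> {x. A x = Some s \<and> x \<notin> fst ` set p}"
      by (auto simp: map_of_eq_None_iff dest: map_of_SomeD)
  qed
  show ?thesis
  proof (cases "s \<in> snd ` set p")
    case False
    then have "{x. (A ++ map_of p) x = Some s} \<subseteq> {x. A x = Some s}" using new by force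
    then show ?thesis using card_mono[OF finA] by (simp add: load_def trans_le_add1)
  next
    case True
    then obtain j where j: "j < length p" "snd (p ! j) = s" by (auto simp: in_set_conv_nth)
    have single: "{x. (x, s) \<in> set p} \<subseteq> {fst (p ! j)}"
    proof
      fix x assume "x \<in> {x. (x, s) \<in> set p}"
      then obtain i where "i < length p" "p ! i = (x, s)" by (auto simp: in_set_conv_nth)
      moreover from this have "i = j"
        using j dist nth_eq_iff_index_eq[of "map snd p" i j] by simp
      ultimately show "x \<in> {fst (p ! j)}" by simp
    qed
    show ?thesis
    proof (cases "s = snd (last p)")
      case True
      have "{x. (A ++ map_of p) x = Some s} \<subseteq> insert (fst (p ! j)) {x. A x = Some s}"
        by (rule order_trans[OF new]) (use single in auto)
      then have "card {x. (A ++ map_of p) x = Some s} \<le> card (insert (fst (p ! j)) {x. A x = Some s})"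
        by (rule card_mono[rotated]) (use finA in simp)
      also have "\<dots> \<le> Suc (card {x. A x = Some s})" by (rule card_insert_le_m1) auto
      finally show ?thesis using True by (simp add: load_def)
    next
      case False
      then have "j \<noteq> length p - 1" using j ne by (auto simp: last_conv_nth)
      then have j1: "Suc j < length p" using j by simp
      let ?y = "fst (p ! Suc j)"
      have y: "A ?y = Some s" "?y \<in> fst ` set p"
        using alternating_path_nth[OF p c j1] j j1 by auto
      have "{x. (A ++ map_of p) x = Some s} \<subseteq> insert (fst (p ! j)) ({x. A x = Some s} - {?y})"
        by (rule order_trans[OF new]) (use single y in auto)
      then have "card {x. (A ++ map_of p) x = Some s}
          \<le> card (insert (fst (p ! j)) ({x. A x = Some s} - {?y}))"
        by (rule card_mono[rotated]) (use finA in simp)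
      also have "\<dots> \<le> Suc (card ({x. A x = Some s} - {?y}))"
        by (rule card_insert_le_m1) auto
      also have "\<dots> = card {x. A x = Some s}"
        using y finA by (intro card_Suc_Diff1) auto
      finally show ?thesis by (simp add: load_def)
    qed
  qed
qed

lemma is_assignment_augment:
  assumes p: "alternating_path E A c p" and A: "is_assignment E C A" and c: "c \<notin> C"
  shows "is_assignment E (insert c C) (A ++ map_of p)"
proof -
  have domA: "dom A = C" and c': "c \<notin> dom A" using A c by (auto simp: is_assignment_def)
  have "fst ` set p \<subseteq> insert c C"
  proof
    fix x assume "x \<in> fst ` set p"
    then obtain j where "j < length p" "x = fst (p ! j)" by (auto simp: in_set_conv_nth)
    then show "x \<in> insert c C"
      using alternating_path_nth[OF p c'] domA p
      by (cases j) (auto simp: alternating_path_def hd_conv_nth)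
  qed
  moreover have "c \<in> fst ` set p"
    using p by (metis alternating_path_def hd_in_set image_eqI)
  ultimately have "dom (A ++ map_of p) = insert c C"
    using domA by (auto simp: dom_map_of_conv_image_fst)
  moreover have "Map.graph (A ++ map_of p) \<subseteq> E"
    using p A by (auto simp: alternating_path_def is_assignment_def Map.graph_def
        dest!: map_of_SomeD)
  ultimately show ?thesis by (simp add: is_assignment_def)
qed

text \<open>The new client is on the path, but its first assignment is not counted; this saves
  one.\<close>

lemma reassignments_augment_le:
  assumes p: "alternating_path E A c p" and c: "c \<notin> dom A"
  shows "reassignments A (A ++ map_of p) \<le> length p - 1"
proof -
  have ne: "p \<noteq> []" "fst (hd p) = c" using p by (auto simp: alternating_path_def)
  have "{x \<in> dom A. (A ++ map_of p) x \<noteq> A x} \<subseteq> fst ` set p - {c}"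
  proof
    fix x assume "x \<in> {x \<in> dom A. (A ++ map_of p) x \<noteq> A x}"
    then have "x \<in> dom A" "map_of p x \<noteq> None"
      by (auto simp: map_add_def split: option.splits)
    then show "x \<in> fst ` set p - {c}" using c by (auto simp: map_of_eq_None_iff)
  qed
  also have "\<dots> \<subseteq> fst ` set (tl p)" using ne by (cases p) auto
  finally have "card {x \<in> dom A. (A ++ map_of p) x \<noteq> A x} \<le> card (fst ` set (tl p))"
    by (rule card_mono[rotated]) simp
  also have "\<dots> \<le> length (tl p)"
    using card_length[of "map fst (tl p)"] by simp
  finally show ?thesis by (simp add: reassignments_def)
qed

section \<open>Steps of the algorithm\<close>

context server_graph
begin

text \<open>If there were no augmenting path, all reachable servers \<open>R\<close> would carry at
  least \<open>k\<close> clients each. These clients together with \<open>c\<close> have all their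
  neighbours in \<open>R\<close>, so \<open>k * card R\<close> would bound one client more than it
  can.\<close>

lemma shortest_augmenting_path_exists:
  assumes fin: "finite C" and dom: "insert c C \<subseteq> Domain E" and c: "c \<notin> C"
    and A: "is_assignment E C A"
  obtains p where "shortest_augmenting_path E (opt S E (insert c C)) A c p"
proof -
  define k where "k = opt S E (insert c C)"
  define R where "R = (\<Union>j. reach E A c j)"
  have domA: "dom A = C" and c': "c \<notin> dom A"
    using A c by (auto simp: is_assignment_def)
  have RS: "R \<subseteq> S" using reach_subset_Range Range_E by (fastforce simp: R_def)
  have "\<exists>p. augmenting_path E k A c p"
  proof (rule ccontr)
    assume none: "\<nexists>p. augmenting_path E k A c p"
    define K where "K = {x. \<exists>s\<in>R. A x = Some s}"
    have KC: "K \<subseteq> C" using domA by (auto simp: K_def)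
    have "k \<le> load A s" if "s \<in> R" for s
      using that none by (auto simp: R_def reach_def augmenting_path_iff not_less)
    then have "k * card R \<le> card K"
      unfolding K_def using saturated_card_le[of A R k] RS finite_S fin domA finite_subset by blast
    moreover have "E `` insert c K \<subseteq> R"
    proof
      fix s assume "s \<in> E `` insert c K"
      then consider "s \<in> E `` {c}" | x where "x \<in> K" "(x, s) \<in> E" by blast
      then show "s \<in> R"
      proof cases
        case 1
        then show ?thesis using reach_one[OF c', of E] by (auto simp: R_def)
      next
        case 2
        then obtain s' j where "A x = Some s'" "s' \<in> reach E A c j" by (auto simp: K_def R_def)
        then have "s \<in> reach E A c (Suc j)" using reach_Suc[OF c'] 2(2) by metis
        then show ?thesis unfolding R_def by blast
      qed
    qed
    then have "card (insert c K) \<le> k * card R"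
      unfolding k_def using KC RS fin dom by (intro card_le_opt_mult) auto
    moreover have "card (insert c K) = Suc (card K)"
      using KC c fin finite_subset by (metis card_insert_disjoint subsetD)
    ultimately show False by simp
  qed
  then obtain p where "augmenting_path E k A c p"
    "\<forall>q. augmenting_path E k A c q \<longrightarrow> length p \<le> length q"
    using ex_has_least_nat[of "augmenting_path E k A c" _ length] by blast
  then show ?thesis using that by (auto simp: shortest_augmenting_path_def k_def)
qed

lemma sap_step_exists:
  assumes "finite C" "insert c C \<subseteq> Domain E" "c \<notin> C" "is_assignment E C A"
  shows "\<exists>A'. sap_step S E C c A A'"
proof (cases "opt S E C < opt S E (insert c C)")
  case True
  moreover obtain s where "(c, s) \<in> E" using assms(2) by blast
  ultimately show ?thesis unfolding sap_step_def by auto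
next
  case False
  obtain p where p: "shortest_augmenting_path E (opt S E (insert c C)) A c p"
    using shortest_augmenting_path_exists[OF assms] .
  then have "alternating_path E A c p"
    by (simp add: shortest_augmenting_path_def augmenting_path_iff)
  then have "Map.graph (A ++ map_of p) = sym_diff (Map.graph A) (path_edges p)"
    using graph_augment assms(3,4) by (metis is_assignment_def)
  then show ?thesis using False p unfolding sap_step_def by auto
qed

lemma sap_step_cases:
  assumes "sap_step S E C c A A'" "dom A = C" "c \<notin> C"
  obtains (increase) s where "opt S E C < opt S E (insert c C)" "(c, s) \<in> E" "A' = A(c \<mapsto> s)"
  | (augment) p where "shortest_augmenting_path E (opt S E (insert c C)) A c p"
      "alternating_path E A c p" "A' = A ++ map_of p"
proof (cases "opt S E C < opt S E (insert c C)")
  case True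
  then show ?thesis using assms(1) increase by (auto simp: sap_step_def)
next
  case False
  then obtain p where p: "shortest_augmenting_path E (opt S E (insert c C)) A c p"
    "Map.graph A' = sym_diff (Map.graph A) (path_edges p)"
    using assms(1) by (auto simp: sap_step_def)
  then have alt: "alternating_path E A c p"
    by (simp add: shortest_augmenting_path_def augmenting_path_iff)
  then have "A' = A ++ map_of p"
    using graph_augment[of E A c p] p(2) assms(2,3) map_graph_inject by metis
  then show ?thesis using augment[of p] p(1) alt by simp
qed

text \<open>In the first case loads grow by at most one, and so does the optimum by at least one. In
  the second case only the last server of the path can gain load, and it was below the
  optimum.\<close>

lemma sap_step_optimal:
  assumes step: "sap_step S E C c A A'" and A: "optimal_assignment S E C A"
    and fin: "finite C" and c: "c \<notin> C" and dom: "insert c C \<subseteq> Domain E"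
  shows "optimal_assignment S E (insert c C) A'"
proof -
  have asg: "is_assignment E C A" and domA: "dom A = C"
    using A by (auto simp: optimal_assignment_def is_assignment_def)
  have mono: "opt S E C \<le> opt S E (insert c C)"
    using fin dom by (intro opt_mono) auto
  from step domA c show ?thesis
  proof (cases rule: sap_step_cases)
    case (increase s)
    have "is_assignment E (insert c C) A'"
      using asg increase by (auto simp: is_assignment_def Map.graph_def split: if_splits)
    moreover have "load A' t \<le> opt S E (insert c C)" if "t \<in> S" for t
    proof -
      have "{x. A' x = Some t} \<subseteq> insert c {x. A x = Some t}" using increase by auto
      moreover have "finite {x. A x = Some t}" by (rule finite_subset[OF _ fin]) (use domA in auto)
      ultimately have "load A' t \<le> card (insert c {x. A x = Some t})"
        unfolding load_def by (intro card_mono) auto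
      also have "\<dots> \<le> Suc (load A t)" unfolding load_def by (rule card_insert_le_m1) auto
      finally show ?thesis using load_le_opt[OF A that] increase(1) by linarith
    qed
    ultimately show ?thesis by (rule optimal_assignmentI)
  next
    case (augment p)
    have "load A' s \<le> opt S E (insert c C)" if "s \<in> S" for s
      using load_augment_le[OF augment(2), of s] load_le_opt[OF A that] mono augment(1,3) c fin domA
      by (auto simp: shortest_augmenting_path_def augmenting_path_iff split: if_splits)
    then show ?thesis
      using is_assignment_augment[OF augment(2) asg c] augment(3) by (blast intro: optimal_assignmentI)
  qed
qed

text \<open>When the optimum increases no old client moves, so any reassignment comes from an
  augmentation.\<close>

lemma sap_step_reassignments:
  assumes "sap_step S E C c A A'" "dom A = C" "c \<notin> C" "0 < reassignments A A'"
  obtains p where "shortest_augmenting_path E (opt S E (insert c C)) A c p"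
    "reassignments A A' < length p"
  using assms(1-3)
proof (cases rule: sap_step_cases)
  case (increase s)
  then have "{x \<in> dom A. A' x \<noteq> A x} = {}" using assms(2,3) by auto
  then have "reassignments A A' = 0" unfolding reassignments_def by (metis card.empty)
  then show ?thesis using assms(4) by simp
next
  case (augment p)
  then have "reassignments A A' \<le> length p - 1" "p \<noteq> []"
    using reassignments_augment_le[of E A c p] assms(2,3) by (auto simp: alternating_path_def)
  then have "reassignments A A' < length p" by (cases p) auto
  then show ?thesis using that augment(1) by blast
qed

end

text \<open>Every server of the path except the last is reached by a proper prefix, hence saturated,
  and these servers are distinct.\<close>

lemma shortest_augmenting_path_length:
  assumes "shortest_augmenting_path E k A c p" "finite (dom A)"
  shows "k * (length p - 1) \<le> card (dom A)"
proof -
  have alt: "alternating_path E A c p"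
    using assms(1) by (simp add: shortest_augmenting_path_def augmenting_path_iff)
  let ?T = "(\<lambda>j. snd (p ! j)) ` {..<length p - 1}"
  have "k \<le> load A s" if s: "s \<in> ?T" for s
  proof -
    obtain j where j: "Suc j < length p" "s = snd (p ! j)" using s by force
    then have "s = snd (last (take (Suc j) p))" by (simp add: take_Suc_conv_app_nth)
    then have "s \<in> reach E A c (Suc j)"
      using alternating_path_take[OF alt, of "Suc j"] unfolding reach_def by force
    then show ?thesis using reach_saturated[OF assms(1)] j by blast
  qed
  then have "k * card ?T \<le> card (dom A)"
    using assms(2) by (intro saturated_card_le_dom) auto
  moreover have "inj_on (\<lambda>j. snd (p ! j)) {..<length p - 1}"
  proof (rule inj_onI)
    fix i j assume "i \<in> {..<length p - 1}" "j \<in> {..<length p - 1}" "snd (p ! i) = snd (p ! j)"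
    then show "i = j"
      using alt nth_eq_iff_index_eq[of "map snd p" i j] by (simp add: alternating_path_def)
  qed
  then have "card ?T = length p - 1" by (simp add: card_image)
  ultimately show ?thesis by simp
qed

section \<open>The excess potential\<close>

text \<open>This is the deficiency in Hall's condition with capacity \<open>x\<close> per server.
  For finite \<open>C\<close> the maximum exists and is nonnegative, because the empty set
  competes.\<close>

definition excess :: "('c \<times> 's) set \<Rightarrow> real \<Rightarrow> 'c set \<Rightarrow> real" where
  "excess E x C = (MAX K\<in>Pow C. real (card K) - x * real (card (E `` K)))"

lemma excess_ge:
  assumes "finite C" "K \<subseteq> C"
  shows "real (card K) - x * real (card (E `` K)) \<le> excess E x C"
  unfolding excess_def by (rule Max_ge) (use assms in auto)

lemma excess_attained:
  assumes "finite C"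
  obtains K where "K \<subseteq> C" "excess E x C = real (card K) - x * real (card (E `` K))"
proof -
  have "excess E x C \<in> (\<lambda>K. real (card K) - x * real (card (E `` K))) ` Pow C"
    unfolding excess_def by (rule Max_in) (use assms in auto)
  then show ?thesis using that by auto
qed

lemma excess_empty: "excess E x {} = 0"
  by (simp add: excess_def)

lemma excess_mono:
  assumes "finite D" "C \<subseteq> D"
  shows "excess E x C \<le> excess E x D"
proof -
  obtain K where "K \<subseteq> C" "excess E x C = real (card K) - x * real (card (E `` K))"
    using excess_attained[OF finite_subset[OF assms(2,1)]] .
  then show ?thesis using excess_ge[OF assms(1), of K x E] assms(2) by auto
qed

lemma excess_insert:
  assumes "finite C" "c \<notin> C" "K \<subseteq> C" "excess E x C = real (card K) - x * real (card (E `` K))"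
    and "E `` {c} \<subseteq> E `` K"
  shows "excess E x C + 1 \<le> excess E x (insert c C)"
proof -
  have "E `` insert c K = E `` K" using assms(5) by blast
  moreover have "card (insert c K) = Suc (card K)"
    using assms finite_subset by (metis card_insert_disjoint subsetD)
  ultimately show ?thesis
    using excess_ge[of "insert c C" "insert c K" x E] assms(1,3,4) by (simp add: subset_insertI2)
qed

section \<open>Upper bound on the excess, and path lengths outside its maximiser\<close>

context server_graph
begin

lemma excess_le:
  assumes "finite C" "C \<subseteq> Domain E" "0 \<le> \<delta>" "\<delta> \<le> 1/2" "card C \<le> n"
  shows "excess E (real (opt S E C) * (1 - \<delta>)) C \<le> 2 * \<delta> * real n"
proof -
  define k where "k = real (opt S E C)"
  obtain K where K: "K \<subseteq> C" "excess E (k * (1 - \<delta>)) C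
      = real (card K) - k * (1 - \<delta>) * real (card (E `` K))"
    using excess_attained[OF assms(1)] .
  define a where "a = real (card K)"
  define b where "b = k * real (card (E `` K))"
  have "card K \<le> opt S E C * card (E `` K)"
    using assms K Range_E by (intro card_le_opt_mult) auto
  then have ab: "a \<le> b" unfolding a_def b_def k_def by (metis of_nat_le_iff of_nat_mult)
  have an: "a \<le> real n"
    using card_mono[OF assms(1) K(1)] assms(5) by (simp add: a_def)
  have ex: "excess E (k * (1 - \<delta>)) C = a - b + \<delta> * b"
    using K(2) by (simp add: a_def b_def algebra_simps)
  have b0: "0 \<le> b" by (simp add: b_def k_def)
  have "a - b + \<delta> * b \<le> 2 * \<delta> * real n"
  \<comment> \<open>For small \<open>b\<close> the inequality \<open>a \<le> b\<close> leaves only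
    \<open>\<delta> * b\<close>. For large \<open>b\<close>, \<open>\<delta> \<le> 1/2\<close> and
    \<open>a \<le> n\<close> make the left side at most \<open>a - b / 2\<close>, which is
    negative.\<close>
  proof (cases "b \<le> 2 * real n")
    case True
    then have "\<delta> * b \<le> \<delta> * (2 * real n)" using assms(3) by (rule mult_left_mono)
    then show ?thesis using ab by (simp add: algebra_simps)
  next
    case False
    have "\<delta> * b \<le> 1/2 * b" using assms(4) b0 by (rule mult_right_mono)
    moreover have "0 \<le> 2 * \<delta> * real n" using assms(3) by simp
    ultimately show ?thesis using False an by linarith
  qed
  then show ?thesis using ex by (simp add: k_def)
qed

text \<open>Outside the neighbourhood of a maximiser \<open>K\<close> the saturated servers multiply
  by at least \<open>1 / (1 - \<delta>)\<close> per search round, starting from at least one and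
  never exceeding \<open>n\<close>.\<close>

lemma shortest_augmenting_path_short:
  assumes p: "shortest_augmenting_path E k A c p" and h: "Suc h < length p"
    and A: "is_assignment E C A" and fin: "finite C" and c: "c \<notin> C" and k: "0 < k"
    and \<delta>: "0 < \<delta>" "\<delta> < 1" and n: "card C \<le> n"
    and K: "K \<subseteq> C" "excess E (real k * (1 - \<delta>)) C
      = real (card K) - real k * (1 - \<delta>) * real (card (E `` K))"
    and free: "\<not> E `` {c} \<subseteq> E `` K"
  shows "\<delta> * real h \<le> ln (real n)"
proof -
  \<comment> \<open>The shift by one makes \<open>T 0\<close> contain the neighbours of
    \<open>c\<close> outside the neighbourhood of \<open>K\<close>; by \<open>free\<close> there is
    one.\<close>
  define T where "T j = reach E A c (Suc j) - E `` K" for j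
  have domA: "dom A = C" and gr: "Map.graph A \<subseteq> E" and c': "c \<notin> dom A"
    using A c by (auto simp: is_assignment_def)
  have finT: "finite (T j)" for j
    by (rule finite_subset[OF _ finite_S])
      (use reach_subset_Range[of E A c "Suc j"] Range_E in \<open>auto simp: T_def\<close>)
  have sat: "k \<le> load A s" if "s \<in> T j" "j \<le> h" for s j
    using reach_saturated[OF p] that h by (auto simp: T_def)
  have grow: "real (card (T j)) \<le> (1 - \<delta>) * real (card (T (Suc j)))" if j: "j \<le> h" for j
  proof -
    define B where "B = {x. \<exists>s\<in>T j. A x = Some s}"
    have BC: "B \<subseteq> C" using domA by (auto simp: B_def)
    have disj: "K \<inter> B = {}"
    proof -
      have "x \<notin> K" if x: "x \<in> B" for x
      proof -
        obtain s where "s \<in> T j" "A x = Some s" using x by (auto simp: B_def)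
        then have "s \<notin> E `` K" "(x, s) \<in> E" using gr by (auto simp: T_def Map.graph_def)
        then show ?thesis by blast
      qed
      then show ?thesis by blast
    qed
    have new: "E `` B - E `` K \<subseteq> T (Suc j)"
      using reach_Suc[OF c'] by (fastforce simp: B_def T_def)
    have "E `` (K \<union> B) = E `` K \<union> (E `` B - E `` K)" by blast
    then have "card (E `` (K \<union> B)) = card (E `` K) + card (E `` B - E `` K)"
      using card_Un_disjoint[of "E `` K" "E `` B - E `` K"] finite_neighbours
      by (metis Diff_disjoint finite_Diff)
    also have "\<dots> \<le> card (E `` K) + card (T (Suc j))"
      using card_mono[OF finT new] by simp
    finally have "real k * (1 - \<delta>) * real (card (E `` (K \<union> B)))
        \<le> real k * (1 - \<delta>) * real (card (E `` K) + card (T (Suc j)))"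
      using \<delta> by (intro mult_left_mono) (simp_all only: of_nat_le_iff, simp)
    moreover have "card (K \<union> B) = card K + card B"
      using K(1) BC disj fin finite_subset by (metis card_Un_disjoint)
    \<comment> \<open>Maximality of \<open>K\<close> enters here: adding the clients
      \<open>B\<close> assigned to \<open>T j\<close> cannot raise the excess.\<close>
    moreover have "real (card (K \<union> B)) - real k * (1 - \<delta>) * real (card (E `` (K \<union> B)))
        \<le> real (card K) - real k * (1 - \<delta>) * real (card (E `` K))"
      using excess_ge[OF fin, of "K \<union> B"] K BC by (metis Un_least)
    ultimately have "real (card B) \<le> real k * ((1 - \<delta>) * real (card (T (Suc j))))"
      by (simp add: algebra_simps)
    moreover have "k * card (T j) \<le> card B"
      unfolding B_def using fin domA finT sat j by (intro saturated_card_le) auto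
    then have "real k * real (card (T j)) \<le> real (card B)"
      by (metis of_nat_le_iff of_nat_mult)
    ultimately have "real k * real (card (T j)) \<le> real k * ((1 - \<delta>) * real (card (T (Suc j))))"
      by linarith
    then show ?thesis using k by simp
  qed
  have growth: "1 \<le> (1 - \<delta>) ^ j * real (card (T j))" if "j \<le> h" for j
    using that
  proof (induction j)
    case 0
    obtain s where "s \<in> T 0" using free reach_one[OF c', of E] by (auto simp: T_def)
    then have "card (T 0) \<noteq> 0" using finT by auto
    then show ?case by simp
  next
    case (Suc j)
    then have "1 \<le> (1 - \<delta>) ^ j * real (card (T j))" by simp
    also have "\<dots> \<le> (1 - \<delta>) ^ j * ((1 - \<delta>) * real (card (T (Suc j))))"
      using grow[of j] Suc.prems \<delta> by (intro mult_left_mono) auto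
    finally show ?case by (simp add: algebra_simps)
  qed
  \<comment> \<open>The last layer used is still saturated because \<open>Suc h < length p\<close>,
    so its size is limited by the number of clients.\<close>
  have "k * card (T h) \<le> card (dom A)"
    using fin domA finT sat by (intro saturated_card_le_dom) auto
  moreover have "card (T h) \<le> k * card (T h)" using k by simp
  ultimately have Tn: "card (T h) \<le> n" using domA n by (metis le_trans)
  have "1 - \<delta> \<le> exp (- \<delta>)" using exp_ge_add_one_self[of "- \<delta>"] by simp
  then have "(1 - \<delta>) ^ h \<le> exp (- \<delta>) ^ h" using \<delta> by (intro power_mono) auto
  also have "\<dots> = exp (- (\<delta> * real h))" by (simp add: exp_of_nat_mult[symmetric] mult.commute)
  finally have "(1 - \<delta>) ^ h * real (card (T h)) \<le> exp (- (\<delta> * real h)) * real n"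
    using Tn by (intro mult_mono) auto
  then have "1 \<le> exp (- (\<delta> * real h)) * real n" using growth[of h] by simp
  then have le: "exp (\<delta> * real h) \<le> real n" by (simp add: exp_minus field_simps)
  then have "0 < real n" using exp_gt_zero less_le_trans by blast
  then show ?thesis using le by (simp add: ln_ge_iff)
qed

end

section \<open>Runs of the algorithm\<close>

lemma set_take_Suc: "i < length cs \<Longrightarrow> set (take (Suc i) cs) = insert (cs ! i) (set (take i cs))"
  by (simp add: take_Suc_conv_app_nth)

lemma nth_notin_set_take:
  assumes "distinct cs" "i < length cs"
  shows "cs ! i \<notin> set (take i cs)"
proof -
  have "distinct (take (Suc i) cs)" using assms(1) by simp
  then show ?thesis using assms(2) by (simp add: take_Suc_conv_app_nth del: distinct_take)
qed

text \<open>Telescoping: each index of \<open>J\<close> contributes at least 1 to the total growth,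
  and the other indices contribute nothing negative.\<close>

lemma card_increments_le:
  fixes f :: "nat \<Rightarrow> real"
  assumes "\<And>i. i < m \<Longrightarrow> f i \<le> f (Suc i)" "J \<subseteq> {..<m}" "\<And>i. i \<in> J \<Longrightarrow> f i + 1 \<le> f (Suc i)"
  shows "real (card J) \<le> f m - f 0"
proof -
  have "real (card J) = (\<Sum>i\<in>J. 1)" by simp
  also have "\<dots> \<le> (\<Sum>i\<in>J. f (Suc i) - f i)"
    using assms(3) by (intro sum_mono) (simp add: algebra_simps)
  also have "\<dots> \<le> (\<Sum>i<m. f (Suc i) - f i)"
    using assms(1,2) by (intro sum_mono2) auto
  also have "\<dots> = f m - f 0" by (rule sum_lessThan_telescope)
  finally show ?thesis .
qed

text \<open>For \<open>n\<close> at least 2 this lets additive constants be absorbed, as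
  \<open>1 \<le> 2 * ln n\<close>.\<close>

lemma half_le_ln:
  fixes x :: real
  assumes "2 \<le> x"
  shows "1 / 2 \<le> ln x"
proof -
  have "exp (1 / 2) \<le> x" using exp_half_le2 assms by (rule order_trans)
  then show ?thesis using assms by (subst ln_ge_iff) auto
qed

context server_graph
begin

lemma sap_run_optimal:
  assumes "sap_run S E cs As" "distinct cs" "set cs \<subseteq> Domain E" "i \<le> length cs"
  shows "optimal_assignment S E (set (take i cs)) (As ! i)"
  using assms(4)
proof (induction i)
  case 0
  have "is_assignment E {} Map.empty" by (simp add: is_assignment_def)
  then have "optimal_assignment S E {} Map.empty"
    by (rule optimal_assignmentI) (simp add: load_def)
  then show ?case using assms(1) by (simp add: sap_run_def)
next
  case (Suc i)
  then have i: "i < length cs" by simp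
  have "sap_step S E (set (take i cs)) (cs ! i) (As ! i) (As ! Suc i)"
    using assms(1) i by (simp add: sap_run_def)
  moreover have "insert (cs ! i) (set (take i cs)) \<subseteq> Domain E"
    using assms(3) i set_take_subset[of i cs] nth_mem[OF i] by blast
  ultimately show ?case
    using sap_step_optimal Suc nth_notin_set_take[OF assms(2) i] set_take_Suc[OF i] by simp
qed

lemma opt_pos:
  assumes "finite C" "C \<subseteq> Domain E" "c \<in> C"
  shows "0 < opt S E C"
  using card_le_opt_mult[OF assms(1,2), of "{c}" S] assms(3) Range_E by (cases "opt S E C") auto

lemma sap_run_reassignments:
  assumes run: "sap_run S E cs As" and dist: "distinct cs" and dom: "set cs \<subseteq> Domain E"
    and i: "i < length cs" and pos: "0 < reassignments (As ! i) (As ! Suc i)"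
  obtains p where
    "shortest_augmenting_path E (opt S E (set (take (Suc i) cs))) (As ! i) (cs ! i) p"
    "reassignments (As ! i) (As ! Suc i) < length p"
proof -
  have step: "sap_step S E (set (take i cs)) (cs ! i) (As ! i) (As ! Suc i)"
    using run i by (simp add: sap_run_def)
  have "dom (As ! i) = set (take i cs)"
    using sap_run_optimal[OF run dist dom, of i] i
    by (simp add: optimal_assignment_def is_assignment_def)
  from sap_step_reassignments[OF step this nth_notin_set_take[OF dist i] pos]
  show ?thesis using that set_take_Suc[OF i] by metis
qed

text \<open>For \<open>\<delta>\<close> of order \<open>ln n / h\<close>, a step with at least
  \<open>h\<close> reassignments must insert a client whose neighbours all lie in the neighbourhood
  of the maximiser. It raises the excess by 1, while the excess stays below
  \<open>2 * \<delta> * n\<close>.\<close>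

lemma card_long_paths_le:
  assumes run: "sap_run S E cs As" and dist: "distinct cs" and dom: "set cs \<subseteq> Domain E"
    and n: "2 \<le> length cs" and h: "1 \<le> h"
  defines "n \<equiv> real (length cs)"
  shows "real (card {i. i < length cs \<and> opt S E (set (take (Suc i) cs)) = k \<and>
            h \<le> reassignments (As ! i) (As ! Suc i)}) \<le> 8 * n * ln n / real h"
    (is "real (card ?J) \<le> _")
proof (cases "real h < 8 * ln n")
  \<comment> \<open>Here the claimed bound is at least \<open>n\<close>, so counting all insertions
    is enough.\<close>
  case True
  have "card ?J \<le> card {..<length cs}" by (rule card_mono) auto
  then have "real (card ?J) \<le> n" by (simp add: n_def)
  also have "\<dots> \<le> n * (8 * ln n / real h)"
    using True h mult_left_mono[of 1 "8 * ln n / real h" n] by (simp add: n_def)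
  finally show ?thesis by (simp add: algebra_simps)
next
  case False
  have ln_n: "1 / 2 \<le> ln n" using half_le_ln[of n] n by (simp add: n_def)
  \<comment> \<open>The factor 4 makes \<open>\<delta> * (h / 2)\<close> equal to
    \<open>2 * ln n\<close>, contradicting the path bound; \<open>h \<ge> 8 * ln n\<close> gives
    \<open>\<delta> \<le> 1/2\<close>.\<close>
  define \<delta> where "\<delta> = 4 * ln n / real h"
  have h2: "2 \<le> h" using False ln_n by simp
  have \<delta>: "0 < \<delta>" "\<delta> \<le> 1 / 2" using False ln_n h2 by (auto simp: \<delta>_def field_simps)
  \<comment> \<open>The capacity stays at \<open>k * (1 - \<delta>)\<close> for all prefixes,
    including those with a smaller optimum, so \<open>f\<close> is monotone from
    \<open>f 0 = 0\<close>.\<close>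
  define f where "f i = excess E (real k * (1 - \<delta>)) (set (take i cs))" for i
  have finJ: "finite ?J" by simp
  show ?thesis
  proof (cases "?J = {}")
    case True
    then show ?thesis using ln_n by (simp only: card.empty) (simp add: n_def)
  next
    case nonempty: False
    \<comment> \<open>The upper bound on the excess needs the optimum to be \<open>k\<close>; this
      holds right after the last counted insertion.\<close>
    define m where "m = Suc (Max ?J)"
    have "Max ?J \<in> ?J" using finJ nonempty by (rule Max_in)
    then have m: "m \<le> length cs" "opt S E (set (take m cs)) = k" by (auto simp: m_def)
    have "f i \<le> f (Suc i)" for i
      unfolding f_def by (rule excess_mono) (simp_all add: set_take_subset_set_take)
    moreover have "?J \<subseteq> {..<m}" using finJ by (auto simp: m_def less_Suc_eq_le)
    moreover have "f i + 1 \<le> f (Suc i)" if J: "i \<in> ?J" for i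
    proof -
      let ?C = "set (take i cs)" and ?c = "cs ! i"
      have i: "i < length cs" and k: "opt S E (set (take (Suc i) cs)) = k"
        and hr: "h \<le> reassignments (As ! i) (As ! Suc i)" using J by auto
      have sub: "set (take (Suc i) cs) \<subseteq> Domain E" using dom set_take_subset by fastforce
      have "0 < k" using opt_pos[OF _ sub, of ?c] k set_take_Suc[OF i] by simp
      have c: "?c \<notin> ?C" using nth_notin_set_take[OF dist i] .
      have asg: "is_assignment E ?C (As ! i)"
        using sap_run_optimal[OF run dist dom, of i] i by (simp add: optimal_assignment_def)
      obtain p where p: "shortest_augmenting_path E k (As ! i) ?c p"
        "reassignments (As ! i) (As ! Suc i) < length p"
        using sap_run_reassignments[OF run dist dom i] hr h k by force
      obtain K where K: "K \<subseteq> ?C" "excess E (real k * (1 - \<delta>)) ?C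
          = real (card K) - real k * (1 - \<delta>) * real (card (E `` K))"
        using excess_attained[of ?C] by auto
      have "E `` {?c} \<subseteq> E `` K"
      proof (rule ccontr)
        assume "\<not> E `` {?c} \<subseteq> E `` K"
        moreover have "Suc (h - 1) < length p" using p(2) hr h by simp
        moreover have "card ?C \<le> length cs"
          using card_length[of "take i cs"] by simp
        ultimately have "\<delta> * real (h - 1) \<le> ln n"
          using shortest_augmenting_path_short[OF p(1) _ asg _ c \<open>0 < k\<close> \<delta>(1) _ _ K] \<delta>(2)
          by (simp add: n_def)
        \<comment> \<open>The path has more than \<open>h\<close> non-assignment edges, which gives
          the growth bound for \<open>h - 1\<close> only; \<open>h \<ge> 2\<close> repairs the
          loss.\<close>
        moreover have "real h / 2 \<le> real (h - 1)" using h2 by simp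
        then have "\<delta> * (real h / 2) \<le> \<delta> * real (h - 1)" using \<delta>(1) by (intro mult_left_mono) auto
        moreover have "\<delta> * (real h / 2) = 2 * ln n" using h by (simp add: \<delta>_def)
        ultimately show False using ln_n by linarith
      qed
      then show ?thesis
        using excess_insert[OF _ c K] set_take_Suc[OF i] by (simp add: f_def)
    qed
    ultimately have "real (card ?J) \<le> f m - f 0" by (rule card_increments_le)
    also have "\<dots> = f m" by (simp add: f_def excess_empty)
    also have "\<dots> \<le> 2 * \<delta> * real (length cs)"
      unfolding f_def m(2)[symmetric] using \<delta> dom set_take_subset[of m cs] card_length[of "take m cs"]
      by (intro excess_le) auto
    finally show ?thesis by (simp add: \<delta>_def n_def algebra_simps)
  qed
qed

end

section \<open>Summation\<close>

text \<open>The increment of \<open>ln\<close> from \<open>n\<close> to \<open>Suc n\<close> is at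
  least \<open>1 / Suc n\<close>, by \<open>ln x \<le> x - 1\<close> at
  \<open>x = n / Suc n\<close>.\<close>

lemma harmonic_sum_le:
  assumes "1 \<le> n" shows "(\<Sum>h=1..n. 1 / real h) \<le> 1 + ln (real n)"
  using assms
proof (induction n rule: dec_induct)
  case base
  then show ?case by simp
next
  case (step n)
  have "ln (real n / real (Suc n)) \<le> real n / real (Suc n) - 1"
    using step.hyps by (intro ln_le_minus_one) auto
  moreover have "real n / real (Suc n) - 1 = - (1 / real (Suc n))" by (simp add: field_simps)
  moreover have "ln (real n / real (Suc n)) = ln (real n) - ln (real (Suc n))"
    using step.hyps by (simp add: ln_div)
  moreover have "(\<Sum>h=1..Suc n. 1 / real h) = (\<Sum>h=1..n. 1 / real h) + 1 / real (Suc n)"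
    by simp
  ultimately show ?case using step.IH by linarith
qed

text \<open>Comparison with the telescoping terms \<open>1 / (n * (n + 1))\<close>.\<close>

lemma inverse_square_sum_le:
  assumes "1 \<le> m" "m \<le> n"
  shows "(\<Sum>h=Suc m..n. 1 / (real h)\<^sup>2) \<le> 1 / real m - 1 / real n"
  using assms(2)
proof (induction n rule: dec_induct)
  case base
  then show ?case by simp
next
  case (step n)
  have n: "0 < real n" using step.hyps assms(1) by simp
  have "1 / (real (Suc n))\<^sup>2 \<le> 1 / (real n * real (Suc n))"
    using n by (intro divide_left_mono) (auto simp: power2_eq_square)
  also have "\<dots> = 1 / real n - 1 / real (Suc n)" using n by (simp add: field_simps)
  finally show ?case using step by simp
qed

lemma sum_nat_eq_sum_card:
  fixes r :: "nat \<Rightarrow> nat"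
  assumes "\<And>i. i < n \<Longrightarrow> r i \<le> m"
  shows "(\<Sum>i<n. r i) = (\<Sum>h=1..m. card {i. i < n \<and> h \<le> r i})"
proof -
  have "r i = (\<Sum>h=1..m. of_bool (h \<le> r i))" if "i < n" for i
  proof -
    have "{1..m} \<inter> {h. h \<le> r i} = {1..r i}" using assms[OF that] by auto
    then show ?thesis by simp
  qed
  then have "(\<Sum>i<n. r i) = (\<Sum>i<n. \<Sum>h=1..m. of_bool (h \<le> r i))" by simp
  also have "\<dots> = (\<Sum>h=1..m. \<Sum>i<n. of_bool (h \<le> r i))" by (rule sum.swap)
  also have "\<dots> = (\<Sum>h=1..m. card {i. i < n \<and> h \<le> r i})"
    by (intro sum.cong) (auto intro: arg_cong[where f = card])
  finally show ?thesis .
qed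

text \<open>The purely numerical part: \<open>r i\<close> stands for the reassignments of a step and
  \<open>k i\<close> for the optimum after it.\<close>

lemma sum_le_of_tail_bounds:
  fixes r k :: "nat \<Rightarrow> nat"
  assumes n: "2 \<le> n" and k: "\<And>i. i < n \<Longrightarrow> 1 \<le> k i \<and> k i \<le> L"
    and rk: "\<And>i. i < n \<Longrightarrow> k i * r i \<le> n"
    and tail: "\<And>l h. 1 \<le> h \<Longrightarrow>
      real (card {i. i < n \<and> k i = l \<and> h \<le> r i}) \<le> 8 * real n * ln (real n) / real h"
  shows "real (\<Sum>i<n. r i) \<le>
    24 * (real n * min (real L * (ln (real n))\<^sup>2) (sqrt (real n) * ln (real n)))"
proof -
  define B where "B = 8 * real n * ln (real n)"
  define N where "N h = real (card {i. i < n \<and> h \<le> r i})" for h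
  have ln_n: "1 / 2 \<le> ln (real n)"
    using half_le_ln[of "real n"] n by simp
  have B0: "0 \<le> B" using ln_n by (simp add: B_def)
  have "r i \<le> n" if "i < n" for i
    using rk[OF that] k[OF that] by (metis le_trans mult_1 mult_le_mono1)
  then have total: "real (\<Sum>i<n. r i) = (\<Sum>h=1..n. N h)"
    unfolding N_def by (subst sum_nat_eq_sum_card) auto
  \<comment> \<open>If only phases with optimum at most \<open>M\<close> reach level
    \<open>h\<close>, the bound of one phase is paid \<open>M\<close> times.\<close>
  have N_le: "N h \<le> real M * (B / real h)"
    if h: "1 \<le> h" and M: "\<And>i. i < n \<Longrightarrow> h \<le> r i \<Longrightarrow> k i \<le> M" for h M
  proof -
    have "{i. i < n \<and> h \<le> r i} = (\<Union>l\<in>{1..M}. {i. i < n \<and> k i = l \<and> h \<le> r i})"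
      using k M by auto
    then have "card {i. i < n \<and> h \<le> r i} \<le> (\<Sum>l=1..M. card {i. i < n \<and> k i = l \<and> h \<le> r i})"
      by (simp only: card_UN_le finite_atLeastAtMost)
    then have "N h \<le> real (\<Sum>l=1..M. card {i. i < n \<and> k i = l \<and> h \<le> r i})"
      unfolding N_def by (rule of_nat_mono)
    also have "\<dots> \<le> (\<Sum>l=1..M. B / real h)"
      unfolding of_nat_sum B_def using tail[OF h] by (intro sum_mono) auto
    finally show ?thesis by simp
  qed
  have "(\<Sum>h=1..n. N h) \<le> (\<Sum>h=1..n. real L * B * (1 / real h))"
    using N_le[of _ L] k by (intro sum_mono) fastforce
  also have "\<dots> = real L * B * (\<Sum>h=1..n. 1 / real h)" by (simp only: sum_distrib_left)
  also have "\<dots> \<le> real L * B * (1 + ln (real n))"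
    using harmonic_sum_le[of n] n B0 by (intro mult_left_mono) auto
  also have "\<dots> \<le> real L * B * (3 * ln (real n))"
    using ln_n B0 by (intro mult_left_mono) auto
  finally have bound1: "real (\<Sum>i<n. r i) \<le> 24 * (real n * (real L * (ln (real n))\<^sup>2))"
    using total by (simp add: B_def power2_eq_square algebra_simps)
  \<comment> \<open>Up to level \<open>m\<close>, about the square root of \<open>n\<close>, each
    \<open>N h\<close> is bounded trivially by \<open>n\<close>; above it the inverse squares sum to
    at most \<open>1 / m\<close>.\<close>
  define m where "m = nat \<lfloor>sqrt (real n)\<rfloor>"
  have s1: "1 \<le> sqrt (real n)" using n by simp
  have m: "1 \<le> m" "real m \<le> sqrt (real n)" and "sqrt (real n) \<le> real m + 1"
    using s1 unfolding m_def by linarith+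
  then have m2: "sqrt (real n) \<le> 2 * real m" by linarith
  have "sqrt (real n) \<le> real n" using mult_left_mono[OF s1, of "sqrt (real n)"] by simp
  then have "m \<le> n" using m(2) by simp
  have N1: "N h \<le> real n" for h
  proof -
    have "card {i. i < n \<and> h \<le> r i} \<le> card {..<n}" by (rule card_mono) auto
    then show ?thesis by (simp add: N_def)
  qed
  \<comment> \<open>A step at level \<open>h\<close> has \<open>k i * h \<le> n\<close>, so at most
    \<open>n div h\<close> phases contribute.\<close>
  have N2: "N h \<le> real n * B * (1 / (real h)\<^sup>2)" if h: "1 \<le> h" for h
  proof -
    have "k i \<le> n div h" if i: "i < n" "h \<le> r i" for i
    proof -
      have "k i * h \<le> n" using rk[OF i(1)] i(2) mult_le_mono2[of h "r i" "k i"] by linarith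
      then show ?thesis using h by (simp add: less_eq_div_iff_mult_less_eq)
    qed
    then have "N h \<le> real (n div h) * (B / real h)" using N_le[OF h] by blast
    also have "\<dots> \<le> real n / real h * (B / real h)"
      using B0 by (intro mult_right_mono) (auto simp: of_nat_div_le_of_nat)
    finally show ?thesis by (simp add: power2_eq_square)
  qed
  have "{1..n} = {1..m} \<union> {Suc m..n}" using \<open>m \<le> n\<close> by auto
  then have "(\<Sum>h=1..n. N h) = (\<Sum>h=1..m. N h) + (\<Sum>h=Suc m..n. N h)"
    by (simp add: sum.union_disjoint)
  also have "\<dots> \<le> (\<Sum>h=1..m. real n) + (\<Sum>h=Suc m..n. real n * B * (1 / (real h)\<^sup>2))"
    using N1 N2 by (intro add_mono sum_mono) auto
  also have "\<dots> = real n * real m + real n * B * (\<Sum>h=Suc m..n. 1 / (real h)\<^sup>2)"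
    by (simp only: sum_distrib_left) simp
  also have "\<dots> \<le> real n * sqrt (real n) + real n * B * (2 / sqrt (real n))"
  proof (intro add_mono mult_left_mono)
    have "(\<Sum>h=Suc m..n. 1 / (real h)\<^sup>2) \<le> 1 / real m"
      using inverse_square_sum_le[OF m(1) \<open>m \<le> n\<close>] by (smt (verit) of_nat_0_le_iff zero_le_divide_1_iff)
    also have "\<dots> \<le> 2 / sqrt (real n)" using m(1) m2 s1 by (simp add: divide_simps)
    finally show "(\<Sum>h=Suc m..n. 1 / (real h)\<^sup>2) \<le> 2 / sqrt (real n)" .
  qed (use m B0 in auto)
  also have "real n * B * (2 / sqrt (real n)) = 16 * (real n * (sqrt (real n) * ln (real n)))"
    using n by (simp add: B_def field_simps)
  \<comment> \<open>The trivial part becomes 2 units of the target, which with the 16 from the tail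
    gives 18.\<close>
  also have "real n * sqrt (real n) \<le> real n * sqrt (real n) * (2 * ln (real n))"
    using ln_n mult_left_mono[of 1 "2 * ln (real n)" "real n * sqrt (real n)"] by simp
  finally have "real (\<Sum>i<n. r i) \<le> 18 * (real n * (sqrt (real n) * ln (real n)))"
    using total by (simp add: algebra_simps)
  also have "\<dots> \<le> 24 * (real n * (sqrt (real n) * ln (real n)))"
    using ln_n by (intro mult_right_mono) auto
  finally show ?thesis using bound1 by (simp add: min_def)
qed

lemma (in server_graph) total_reassignments_le:
  assumes run: "sap_run S E cs As" and dist: "distinct cs" and dom: "set cs \<subseteq> Domain E"
  defines "n \<equiv> real (length cs)" and "L \<equiv> real (opt S E (set cs))"
  shows "real (total_reassignments As) \<le> 24 * (n * min (L * (ln n)\<^sup>2) (sqrt n * ln n))"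
proof -
  define r where "r i = reassignments (As ! i) (As ! Suc i)" for i
  define k where "k i = opt S E (set (take (Suc i) cs))" for i
  have total: "total_reassignments As = (\<Sum>i<length cs. r i)"
    using run by (simp add: total_reassignments_def sap_run_def r_def)
  show ?thesis
  proof (cases "2 \<le> length cs")
    case True
    have "1 \<le> k i \<and> k i \<le> opt S E (set cs)" if i: "i < length cs" for i
    proof -
      have "set (take (Suc i) cs) \<subseteq> set cs" by (rule set_take_subset)
      then show ?thesis
        using opt_pos[of "set (take (Suc i) cs)" "cs ! i"] opt_mono[of "set cs"] dom
        by (auto simp: k_def set_take_Suc[OF i] Suc_le_eq)
    qed
    moreover have "k i * r i \<le> length cs" if i: "i < length cs" for i
    proof (cases "r i = 0")
      case False
      then obtain p where p: "shortest_augmenting_path E (k i) (As ! i) (cs ! i) p" "r i < length p"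
        using sap_run_reassignments[OF run dist dom i] by (auto simp: r_def k_def)
      have domA: "dom (As ! i) = set (take i cs)"
        using sap_run_optimal[OF run dist dom, of i] i
        by (simp add: optimal_assignment_def is_assignment_def)
      have "k i * r i \<le> k i * (length p - 1)" using p(2) by (intro mult_le_mono2) simp
      also have "\<dots> \<le> card (set (take i cs))"
        using shortest_augmenting_path_length[OF p(1)] domA by simp
      also have "\<dots> \<le> length cs" using card_length[of "take i cs"] by simp
      finally show ?thesis .
    qed simp
    ultimately show ?thesis
      unfolding total n_def L_def
      using card_long_paths_le[OF run dist dom True] True
      by (intro sum_le_of_tail_bounds[where k = k]) (auto simp: r_def k_def)
  next
    case False
    \<comment> \<open>The logarithm is no help here: for one client the right side is 0, and indeed
      the first insertion has no old client to move.\<close>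
    then consider "length cs = 0" | "length cs = 1" by linarith
    then show ?thesis
    proof cases
      case 1
      then show ?thesis using total by (simp add: n_def)
    next
      case 2
      then have "r 0 = 0" using run by (simp add: r_def reassignments_def sap_run_def)
      then show ?thesis using total 2 by (simp add: n_def)
    qed
  qed
qed

text \<open>The first conjunct keeps the rest from being vacuous: every partial run can be
  continued. The constant 24 serves all instances.\<close>

theorem theorem5:
  shows "\<exists>K::real. \<forall>(S :: 's set) (E :: ('c \<times> 's) set) (cs :: 'c list).
    online_instance S E cs \<longrightarrow>
      (\<forall>i < length cs. \<forall>As. sap_run S E (take i cs) As \<longrightarrow>
         (\<exists>A'. sap_step S E (set (take i cs)) (cs ! i) (last As) A')) \<and>
      (\<forall>As. sap_run S E cs As \<longrightarrow>
         (\<forall>i \<le> length cs. optimal_assignment S E (set (take i cs)) (As ! i)) \<and>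
         (let n = real (card (set cs)); L = real (opt S E (set cs)) in
            real (total_reassignments As) \<le> K * (n * min (L * (ln n)\<^sup>2) (sqrt n * ln n))))"
proof (intro exI[of _ 24] allI impI)
  fix S :: "'s set" and E :: "('c \<times> 's) set" and cs :: "'c list"
  assume inst: "online_instance S E cs"
  then have dist: "distinct cs" and dom: "set cs \<subseteq> Domain E"
    by (auto simp: online_instance_def)
  interpret server_graph S E
    using inst by unfold_locales (auto simp: online_instance_def)
  have "\<exists>A'. sap_step S E (set (take i cs)) (cs ! i) (last As) A'"
    if i: "i < length cs" and run: "sap_run S E (take i cs) As" for i As
  proof -
    have sub: "insert (cs ! i) (set (take i cs)) \<subseteq> Domain E"
      using dom i set_take_subset[of i cs] nth_mem[OF i] by blast
    have "length As = Suc i" using run i by (simp add: sap_run_def)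
    then have "last As = As ! i" by (metis diff_Suc_1 last_conv_nth length_0_conv nat.distinct(1))
    then have "optimal_assignment S E (set (take i cs)) (last As)"
      using sap_run_optimal[OF run, of i] dist sub i by simp
    then show ?thesis
      using sap_step_exists[OF _ sub nth_notin_set_take[OF dist i]]
      by (simp add: optimal_assignment_def)
  qed
  then show "(\<forall>i < length cs. \<forall>As. sap_run S E (take i cs) As \<longrightarrow>
         (\<exists>A'. sap_step S E (set (take i cs)) (cs ! i) (last As) A')) \<and>
      (\<forall>As. sap_run S E cs As \<longrightarrow>
         (\<forall>i \<le> length cs. optimal_assignment S E (set (take i cs)) (As ! i)) \<and>
         (let n = real (card (set cs)); L = real (opt S E (set cs)) in
            real (total_reassignments As) \<le> 24 * (n * min (L * (ln n)\<^sup>2) (sqrt n * ln n))))"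
    using sap_run_optimal[OF _ dist dom] total_reassignments_le[OF _ dist dom]
    by (simp add: Let_def distinct_card[OF dist])
qed

end
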